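(* Let $n\ge1$ and $\lambda\in\mathbb{R}\setminus\{0\}$. For any non-constant $\varphi\in\mathcal{F}^\lambda(\mathbb{C}^{2n})$, at least one of the operators $S_\varphi$ and $\widetilde S_\varphi$ fails to be bounded on $\mathcal{F}^\lambda(\mathbb{C}^{2n})$.
   Context: Notation: for $z,a\in\mathbb{C}^n$ write $z\cdot \bar a=\sum_j z_j\bar a_j$, $|z|^2=z\cdot\bar z$. The weight on $\mathbb{C}^{2n}$ is $w_\lambda(z,w)=e^{\lambda\,\Im(z\cdot\bar w)}\,e^{-\frac12\lambda(\coth\lambda)(|z|^2+|w|^2)}$. The twisted Fock space $\mathcal{F}^\lambda(\mathbb{C}^{2n})$ is the Hilbert space of entire functions $F$ on $\mathbb{C}^{2n}$ with $\|F\|^2=\int_{\mathbb{C}^{2n}}|F(z,w)|^2w_\lambda(z,w)\,dz\,dw<\infty$. For $\varphi\in\mathcal{F}^\lambda(\mathbb{C}^{2n})$ define $$S_\varphi F(z,w)=\int_{\mathbb{C}^{2n}}F(a,b)\,\varphi(z-\bar a,w-\bar b)\,e^{\frac12\lambda(\coth\lambda)(z\cdot\bar a+w\cdot\bar b)}\,e^{-\frac i2\lambda(w\cdot\bar a-z\cdot\bar b)}\,w_\lambda(a,b)\,da\,db ,$$ $$\widetilde S_\varphi F(z,w)=\int_{\mathbb{C}^{2n}}F(a,b)\,\varphi(z+\bar a,w+\bar b)\,e^{\frac12\lambda(\coth\lambda)(z\cdot\bar a+w\cdot\bar b)}\,e^{-\frac i2\lambda(w\cdot\bar a-z\cdot\bar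 b)}\,w_\lambda(a,b)\,da\,db .$$ *)

theory Defs
  imports "HOL-Analysis.Analysis"
begin

text \<open>C^n is modelled as complex^'n for a finite (nonempty) index type 'n, so n = CARD('n) \<ge> 1.
  C^{2n} is modelled as pairs (z,w) of such vectors; Lebesgue measure dz dw is lborel on the product.\<close>

type_synonym 'n cvec2 = "(complex^'n) \<times> (complex^'n)"

definition cdot :: "complex^('n::finite) \<Rightarrow> complex^'n \<Rightarrow> complex" where
  "cdot z a = (\<Sum>j\<in>UNIV. z $ j * cnj (a $ j))"

definition cnorm2 :: "complex^('n::finite) \<Rightarrow> real" where
  "cnorm2 z = (\<Sum>j\<in>UNIV. (cmod (z $ j))^2)"

definition vcnj :: "complex^('n::finite) \<Rightarrow> complex^'n" where
  "vcnj a = (\<chi> j. cnj (a $ j))"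

definition coth :: "real \<Rightarrow> real" where
  "coth x = cosh x / sinh x"

definition cscale2 :: "complex \<Rightarrow> 'n::finite cvec2 \<Rightarrow> 'n cvec2" where
  "cscale2 c p = ((\<chi> j. c * fst p $ j), (\<chi> j. c * snd p $ j))"

definition entire2 :: "('n::finite cvec2 \<Rightarrow> complex) \<Rightarrow> bool" where
  "entire2 F \<longleftrightarrow> (\<forall>p. \<exists>L. (F has_derivative L) (at p) \<and>
                        (\<forall>c v. L (cscale2 c v) = c * L v))"

definition wlam :: "real \<Rightarrow> 'n::finite cvec2 \<Rightarrow> real" where
  "wlam lam p = exp (lam * Im (cdot (fst p) (snd p)))
              * exp (- (1/2) * lam * coth lam * (cnorm2 (fst p) + cnorm2 (snd p)))"

definition fock :: "real \<Rightarrow> ('n::finite cvec2 \<Rightarrow> complex) set" where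
  "fock lam = {F. entire2 F \<and> integrable lborel (\<lambda>p. (cmod (F p))^2 * wlam lam p)}"

definition fock_norm :: "real \<Rightarrow> ('n::finite cvec2 \<Rightarrow> complex) \<Rightarrow> real" where
  "fock_norm lam F = sqrt (\<integral>p. (cmod (F p))^2 * wlam lam p \<partial>lborel)"

text \<open>Integrand of S_phi (sgn = 1) and of S~_phi (sgn = -1) at the point p = (z,w),
  integration variable q = (a,b).\<close>
definition S_kernel :: "real \<Rightarrow> real \<Rightarrow> ('n::finite cvec2 \<Rightarrow> complex) \<Rightarrow> ('n cvec2 \<Rightarrow> complex)
    \<Rightarrow> 'n cvec2 \<Rightarrow> 'n cvec2 \<Rightarrow> complex" where
  "S_kernel lam s \<phi> F p q =
     (let z = fst p; w = snd p; a = fst q; b = snd q in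
       F q * \<phi> (z - s *\<^sub>R vcnj a, w - s *\<^sub>R vcnj b)
       * exp (complex_of_real ((1/2) * lam * coth lam) * (cdot z a + cdot w b))
       * exp (- (\<i> / 2) * complex_of_real lam * (cdot w a - cdot z b))
       * complex_of_real (wlam lam q))"


definition S_op :: "real \<Rightarrow> real \<Rightarrow> ('n::finite cvec2 \<Rightarrow> complex) \<Rightarrow> ('n cvec2 \<Rightarrow> complex)
    \<Rightarrow> 'n cvec2 \<Rightarrow> complex" where
  "S_op lam s \<phi> F p = (\<integral>q. S_kernel lam s \<phi> F p q \<partial>lborel)"

definition bounded_on_fock :: "real \<Rightarrow> (('n::finite cvec2 \<Rightarrow> complex) \<Rightarrow> ('n cvec2 \<Rightarrow> complex))
    \<Rightarrow> ((('n cvec2 \<Rightarrow> complex) \<Rightarrow> 'n cvec2 \<Rightarrow> 'n cvec2 \<Rightarrow> complex)) \<Rightarrow> bool" where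
  "bounded_on_fock lam T K \<longleftrightarrow> (\<exists>C. \<forall>F\<in>fock lam.
      (\<forall>p. integrable lborel (K F p)) \<and> T F \<in> fock lam \<and> fock_norm lam (T F) \<le> C * fock_norm lam F)"

end

theory Submission
  imports Defs "HOL-Probability.Distributions" "HOL-Complex_Analysis.Complex_Analysis"
begin

text \<open>
  The weight is exp (- H(p,p)) for a positive definite Hermitian form H, and K_u = exp H(_,u) is, up to
  a constant, the reproducing kernel. The mean value property, averaged over the rotations
  v \<open>\<mapsto>\<close> exp (it) v, gives S K_u (p) = I \<open>\<phi>\<close>(p - s cnj u) K_u(p) with I the integral of the weight, and
  bounds point evaluations. Hence boundedness of the operator of sign s implies
  |\<open>\<phi>\<close>(p - s cnj u)| \<open>\<le>\<close> C exp (H(p-u,p-u)/2) for all p and u. For s = 1 this bounds \<open>\<phi>\<close>(x + iy) by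
  C exp (H(x,x)/2), and for s = -1 by C exp (H(y,y)/2). If both operators are bounded, then
  on each complex line through 0 with real direction \<open>\<phi>\<close> is an entire function dominated by
  C exp (k min (Re z^2, Im z^2)), which Phragmen-Lindelof and Liouville force to be constant. So \<open>\<phi>\<close> is
  constant on real vectors, hence everywhere by the identity theorem.
\<close>

section \<open>Isometries, Gaussians and circle means\<close>

lemma nn_integral_lborel_translate:
  fixes h :: "'a::euclidean_space \<Rightarrow> ennreal"
  assumes [measurable]: "h \<in> borel_measurable borel"
  shows "(\<integral>\<^sup>+x. h (c + x) \<partial>lborel) = (\<integral>\<^sup>+x. h x \<partial>lborel)"
proof -
  have "(\<integral>\<^sup>+x. h x \<partial>lborel) = (\<integral>\<^sup>+x. h x \<partial>(distr lborel borel ((+) c)))"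
    by (simp add: lborel_distr_plus)
  also have "\<dots> = (\<integral>\<^sup>+x. h (c + x) \<partial>lborel)"
    by (subst nn_integral_distr) auto
  finally show ?thesis by simp
qed

text \<open>The uniqueness argument for Haar measure: the double integral of
  1_A (f x + y) 1_B (y), with B the unit ball, is evaluated in both orders. Since f maps B to itself,
  the factor relating the image measure to Lebesgue measure is 1.\<close>

lemma lborel_distr_linear_isometry:
  fixes f :: "'a::euclidean_space \<Rightarrow> 'a"
  assumes lin: "linear f" and iso: "\<And>x. norm (f x) = norm x"
  shows "distr lborel borel f = lborel"
proof (rule measure_eqI)
  have cont: "continuous_on UNIV f" using lin by (simp add: linear_continuous_on linear_conv_bounded_linear)
  have fm[measurable]: "f \<in> borel_measurable borel" using cont by (rule borel_measurable_continuous_onI)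
  have "inj f" using lin iso by (metis linear_injective_0 norm_eq_zero)
  then have sur: "surj f" using lin linear_injective_imp_surjective by blast
  \<comment> \<open>As \<open>f\<close> is onto, shifting \<open>f x\<close> by \<open>y\<close>
    amounts to shifting \<open>x\<close> by a preimage of \<open>y\<close>, so the image measure
    inherits translation invariance.\<close>
  have inv: "(\<integral>\<^sup>+x. h (f x + y) \<partial>lborel) = (\<integral>\<^sup>+x. h (f x) \<partial>lborel)"
    if [measurable]: "h \<in> borel_measurable borel" for h :: "'a \<Rightarrow> ennreal" and y
  proof -
    obtain z where z: "y = f z" using sur by (metis surjD)
    have "h (f x + y) = h (f (z + x))" for x
      by (simp add: z linear_add[OF lin] add.commute)
    then show ?thesis using nn_integral_lborel_translate[of "\<lambda>x. h (f x)" z] by simp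
  qed
  let ?B = "ball (0::'a) 1"
  let ?b = "emeasure lborel ?B"
  fix A assume "A \<in> sets (distr lborel borel f)"
  then have A[measurable]: "A \<in> sets borel" by simp
  have f1: "(\<lambda>p. f (fst p)) \<in> borel_measurable (lborel \<Otimes>\<^sub>M lborel)"
    by (rule measurable_compose[of fst _ lborel]) auto
  have m1: "(\<lambda>p. f (fst p) + snd p) \<in> borel_measurable (lborel \<Otimes>\<^sub>M lborel)"
    and m2: "(\<lambda>p. f (fst p) - snd p) \<in> borel_measurable (lborel \<Otimes>\<^sub>M lborel)"
    using f1 measurable_snd[of lborel lborel] by (auto intro!: borel_measurable_add borel_measurable_diff)
  have m3: "(\<lambda>(x, y). indicator A (f x + y) * indicator ?B y :: ennreal) \<in> borel_measurable (lborel \<Otimes>\<^sub>M lborel)"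
    unfolding case_prod_beta
    by (intro borel_measurable_times_ennreal measurable_compose[OF m1 borel_measurable_indicator[OF A]]
          measurable_compose[OF measurable_snd borel_measurable_indicator]) simp
  have mB: "(indicator ?B :: 'a \<Rightarrow> ennreal) \<in> borel_measurable borel"
    by (rule borel_measurable_indicator) simp
  have fB: "(\<lambda>x. indicator ?B (f x - y) :: ennreal) \<in> borel_measurable borel" for y
    by (rule measurable_compose[OF borel_measurable_diff[OF fm borel_measurable_const] mB])
  have snd: "snd \<in> borel_measurable (lborel \<Otimes>\<^sub>M (lborel :: 'a measure))"
    using measurable_snd[of lborel lborel] by simp
  have m4: "(\<lambda>(x, y). indicator A y * indicator ?B (f x - y) :: ennreal) \<in> borel_measurable (lborel \<Otimes>\<^sub>M lborel)"
    unfolding case_prod_beta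
    by (rule borel_measurable_times_ennreal[OF measurable_compose[OF snd borel_measurable_indicator[OF A]]
          measurable_compose[OF m2 mB]])
  have "(\<integral>\<^sup>+x. \<integral>\<^sup>+y. indicator A (f x + y) * indicator ?B y \<partial>lborel \<partial>lborel)
      = (\<integral>\<^sup>+y. \<integral>\<^sup>+x. indicator A (f x + y) * indicator ?B y \<partial>lborel \<partial>lborel)"
    by (rule lborel_pair.Fubini'[symmetric, OF m3])
  also have "\<dots> = (\<integral>\<^sup>+y. (\<integral>\<^sup>+x. indicator A (f x) \<partial>lborel) * indicator ?B y \<partial>lborel)"
    by (subst nn_integral_multc, simp, subst inv, simp_all)
  also have "\<dots> = (\<integral>\<^sup>+x. indicator A (f x) \<partial>lborel) * ?b"
    by (rule nn_integral_cmult_indicator) simp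
  also have "(\<integral>\<^sup>+x. indicator A (f x) \<partial>lborel) = emeasure (distr lborel borel f) A"
    using nn_integral_distr[of f lborel borel "indicator A"] by simp
  finally have 1: "(\<integral>\<^sup>+x. \<integral>\<^sup>+y. indicator A (f x + y) * indicator ?B y \<partial>lborel \<partial>lborel)
     = emeasure (distr lborel borel f) A * ?b" .
  \<comment> \<open>Translating \<open>y\<close> by \<open>f x\<close> moves the shift from
    \<open>A\<close> to the ball, so that the integral over \<open>x\<close> now meets the ball,
    which \<open>f\<close> preserves.\<close>
  have "(\<integral>\<^sup>+y. indicator A (f x + y) * indicator ?B y \<partial>lborel)
     = (\<integral>\<^sup>+y. indicator A y * indicator ?B (f x - y) \<partial>lborel)" for x
    using nn_integral_lborel_translate[of "\<lambda>y. indicator A y * indicator ?B (f x - y)" "f x"]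
    by (simp add: indicator_def)
  then have "(\<integral>\<^sup>+x. \<integral>\<^sup>+y. indicator A (f x + y) * indicator ?B y \<partial>lborel \<partial>lborel)
     = (\<integral>\<^sup>+x. \<integral>\<^sup>+y. indicator A y * indicator ?B (f x - y) \<partial>lborel \<partial>lborel)" by simp
  also have "\<dots> = (\<integral>\<^sup>+y. \<integral>\<^sup>+x. indicator A y * indicator ?B (f x - y) \<partial>lborel \<partial>lborel)"
    by (rule lborel_pair.Fubini'[symmetric, OF m4])
  also have "\<dots> = (\<integral>\<^sup>+y. indicator A y * (\<integral>\<^sup>+x. indicator ?B (f x + - y) \<partial>lborel) \<partial>lborel)"
    using fB by (subst nn_integral_cmult) auto
  also have "\<dots> = (\<integral>\<^sup>+y. indicator A y * (\<integral>\<^sup>+x. indicator ?B (f x) \<partial>lborel) \<partial>lborel)"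
    using mB by (subst inv) auto
  also have "(\<lambda>x. indicator ?B (f x) :: ennreal) = indicator ?B"
    by (auto simp: indicator_def iso)
  also have "(\<integral>\<^sup>+y. indicator A y * (\<integral>\<^sup>+x. indicator ?B x \<partial>lborel) \<partial>lborel) = emeasure lborel A * ?b"
    by (subst nn_integral_multc) auto
  finally have 2: "emeasure (distr lborel borel f) A * ?b = emeasure lborel A * ?b" using 1 by simp
  have "emeasure lebesgue ?B = ?b" by simp
  then have b0: "?b \<noteq> 0" using open_not_negligible[of ?B] negligible_iff_emeasure0[of ?B] by auto
  have "?b < \<infinity>" using emeasure_lborel_ball_finite[of "0::'a" 1] by simp
  then show "emeasure (distr lborel borel f) A = emeasure lborel A"
    using 2 b0 by (auto simp: mult.commute[of _ ?b] ennreal_mult_cancel_left)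
qed simp

lemma lborel_linear_isometry:
  fixes f :: "'a::euclidean_space \<Rightarrow> 'a" and g :: "'a \<Rightarrow> 'b::{banach,second_countable_topology}"
  assumes lin: "linear f" and iso: "\<And>x. norm (f x) = norm x" and g: "g \<in> borel_measurable borel"
  shows integrable_lborel_linear_isometry: "integrable lborel (\<lambda>x. g (f x)) \<longleftrightarrow> integrable lborel g"
    and integral_lborel_linear_isometry: "(\<integral>x. g (f x) \<partial>lborel) = (\<integral>x. g x \<partial>lborel)"
proof -
  have cont: "continuous_on UNIV f" using lin by (simp add: linear_continuous_on linear_conv_bounded_linear)
  have f: "f \<in> measurable lborel borel" using borel_measurable_continuous_onI[OF cont] by simp
  show "integrable lborel (\<lambda>x. g (f x)) \<longleftrightarrow> integrable lborel g"
    using integrable_distr_eq[OF f g] lborel_distr_linear_isometry[OF lin iso] by simp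
  show "(\<integral>x. g (f x) \<partial>lborel) = (\<integral>x. g x \<partial>lborel)"
    using integral_distr[OF f g] lborel_distr_linear_isometry[OF lin iso] by simp
qed

lemma lborel_translate:
  fixes g :: "'a::euclidean_space \<Rightarrow> 'b::{banach,second_countable_topology}"
  assumes "g \<in> borel_measurable borel"
  shows integrable_lborel_translate: "integrable lborel (\<lambda>x. g (c + x)) \<longleftrightarrow> integrable lborel g"
    and integral_lborel_translate: "(\<integral>x. g (c + x) \<partial>lborel) = (\<integral>x. g x \<partial>lborel)"
  using integrable_distr_eq[of "(+) c" lborel borel g] integral_distr[of "(+) c" lborel borel g]
    lborel_distr_plus[of c] assms by auto

text \<open>In one dimension the function is a multiple of a normal density; in general it is a
  product of such functions over the coordinates.\<close>

lemma integrable_gaussian: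
  assumes "k > 0"
  shows "integrable lborel (\<lambda>x::'a::euclidean_space. exp (- k * (norm x)\<^sup>2))"
proof -
  \<comment> \<open>The variance 1/(2k) turns the exponent of the normal density into
    \<open>- k * x\<^sup>2\<close>.\<close>
  define s where "s = sqrt (1 / (2 * k))"
  have s: "s > 0" "2 * s\<^sup>2 = 1 / k" using assms by (auto simp: s_def)
  have "integrable lborel (\<lambda>x. sqrt (2 * pi * s\<^sup>2) * normal_density 0 s x)" using s by (intro integrable_mult_right) auto
  also have "(\<lambda>x. sqrt (2 * pi * s\<^sup>2) * normal_density 0 s x) = (\<lambda>x. exp (- k * x\<^sup>2))"
    using s assms by (auto simp: normal_density_def fun_eq_iff)
  finally have 1: "integrable lborel (\<lambda>x::real. exp (- k * x\<^sup>2))" .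
  interpret product_sigma_finite "\<lambda>_. lborel :: real measure" ..
  have "integrable (\<Pi>\<^sub>M b\<in>Basis. lborel) (\<lambda>x. \<Prod>b\<in>(Basis::'a set). exp (- k * (x b)\<^sup>2))"
    by (rule product_integrable_prod) (use 1 in auto)
  also have "(\<lambda>x. \<Prod>b\<in>(Basis::'a set). exp (- k * (x b)\<^sup>2)) =
     (\<lambda>x. exp (- k * (norm (\<Sum>b\<in>(Basis::'a set). x b *\<^sub>R b))\<^sup>2))"
  proof
    fix x :: "'a \<Rightarrow> real"
    have "(norm (\<Sum>b\<in>(Basis::'a set). x b *\<^sub>R b))\<^sup>2 = (\<Sum>b\<in>Basis. (x b)\<^sup>2)"
      unfolding power2_norm_eq_inner by (subst euclidean_inner) (simp add: power2_eq_square)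
    then show "(\<Prod>b\<in>(Basis::'a set). exp (- k * (x b)\<^sup>2)) = exp (- k * (norm (\<Sum>b\<in>(Basis::'a set). x b *\<^sub>R b))\<^sup>2)"
      by (simp add: exp_sum[symmetric] sum_distrib_left sum_negf)
  qed
  finally show ?thesis by (subst lborel_eq, subst integrable_distr_eq) auto
qed

text \<open>Cauchy's formula at the centre of the unit circle: the derivative of the parametrization
  cancels the denominator. The Lebesgue integral is the form needed for Fubini.\<close>

lemma circle_mean_value:
  assumes "h holomorphic_on UNIV"
  shows "(LINT t:{0..1}|lborel. h (cis (2 * pi * t))) = h 0"
proof -
  have e: "exp (2 * of_real pi * \<i> * of_real t) = cis (2 * pi * t)" for t
    by (simp add: cis_conv_exp mult_ac)
  have vd: "vector_derivative (circlepath 0 1) (at t within {0..1}) = 2 * of_real pi * \<i> * cis (2 * pi * t)"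
    if "0 \<le> t" "t \<le> 1" for t
    using vector_derivative_circlepath01[OF that, of 0 1] by (simp add: e)
  have cp: "circlepath 0 1 t = cis (2 * pi * t)" for t by (simp add: circlepath e)
  have "((\<lambda>u. h u / (u - 0)) has_contour_integral (2 * of_real pi * \<i> * h 0)) (circlepath 0 1)"
    by (rule Cauchy_integral_circlepath)
      (use assms in \<open>auto intro: holomorphic_on_imp_continuous_on holomorphic_on_subset\<close>)
  then have "((\<lambda>t. h (cis (2 * pi * t)) / cis (2 * pi * t) * (2 * of_real pi * \<i> * cis (2 * pi * t))) has_integral 2 * of_real pi * \<i> * h 0) {0..1}"
    unfolding has_contour_integral_def
    by (rule has_integral_eq[rotated]) (simp add: vd cp)
  then have "((\<lambda>t. (2 * of_real pi * \<i>) * h (cis (2 * pi * t))) has_integral (2 * of_real pi * \<i>) * h 0) {0..1}"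
    by (rule has_integral_eq[rotated]) simp
  then have 1: "((\<lambda>t. h (cis (2 * pi * t))) has_integral h 0) {0..1}"
    by (simp add: has_integral_cmul_iff has_integral_mult_right_iff)
  have "continuous_on {0..1} (\<lambda>t. h (cis (2 * pi * t)))"
    using holomorphic_on_imp_continuous_on[OF assms]
    by (auto intro!: continuous_intros continuous_on_compose2[of UNIV h])
  then have "set_integrable lborel {0..1} (\<lambda>t. h (cis (2 * pi * t)))"
    by (rule borel_integrable_atLeastAtMost')
  then show ?thesis using set_borel_integral_eq_integral(2) 1 by (metis integral_unique)
qed

section \<open>A Phragmen-Lindelof argument\<close>

text \<open>After exp (sigma x) is taken out, the other factor e exp (tau x) - K still tends to
  infinity. Hence damping of order sigma + tau defeats growth of order sigma.\<close>

lemma exp_exp_dominated: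
  fixes K e \<sigma> \<tau> :: real
  assumes "K > 0" "e > 0" "\<sigma> > 0" "\<tau> > 0"
  shows "((\<lambda>x. exp (K * exp (\<sigma> * x) - e * exp ((\<sigma> + \<tau>) * x))) \<longlongrightarrow> 0) at_top"
proof -
  have "filterlim (\<lambda>x. exp (\<sigma> * x) * (e * exp (\<tau> * x) - K)) at_top at_top"
    by (intro filterlim_at_top_mult_at_top filterlim_compose[OF exp_at_top]
          filterlim_tendsto_pos_mult_at_top[OF tendsto_const] filterlim_ident assms
          filterlim_tendsto_add_at_top[OF tendsto_const[of "- K"], simplified])
  moreover have "K * exp (\<sigma> * x) - e * exp ((\<sigma> + \<tau>) * x) = - (exp (\<sigma> * x) * (e * exp (\<tau> * x) - K))" for x
    by (simp add: algebra_simps exp_add)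
  ultimately show ?thesis
    by (simp add: filterlim_uminus_at_bot filterlim_compose[OF exp_at_bot])
qed

text \<open>A factor exp (-eps exp (rho (t - i m))), with m the middle height, has modulus at most 1
  on the strip and forces decay to the right. The maximum principle on a rectangle applies, and then
  eps tends to 0. On the left the bound is a hypothesis: in the application exp maps that end into a
  neighbourhood of 0.\<close>

lemma phragmen_lindelof_strip:
  fixes h :: "complex \<Rightarrow> complex"
  assumes hol: "h holomorphic_on UNIV" and \<sigma>: "\<sigma> > 0" "\<sigma> * (b - a) < pi" and M: "M > 0"
    and bottom: "\<And>t. Im t = a \<Longrightarrow> cmod (h t) \<le> M"
    and top: "\<And>t. Im t = b \<Longrightarrow> cmod (h t) \<le> M"
    and left: "\<And>t. Im t \<in> {a..b} \<Longrightarrow> Re t \<le> L0 \<Longrightarrow> cmod (h t) \<le> M"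
    and growth: "\<And>t. Im t \<in> {a..b} \<Longrightarrow> cmod (h t) \<le> B * exp (K * exp (\<sigma> * Re t))"
    and t: "Im t \<in> {a..b}"
  shows "cmod (h t) \<le> M"
proof (cases "a = b")
  case True
  then show ?thesis using bottom t by auto
next
  case False
  then have ab: "a < b" using t by auto
  \<comment> \<open>\<open>K\<close> may be nonpositive, while \<open>exp_exp_dominated\<close>
    needs a positive constant.\<close>
  define K' where "K' = \<bar>K\<bar> + 1"
  have K': "K' > 0" "K \<le> K'" by (auto simp: K'_def)
  \<comment> \<open>An order above \<open>\<sigma>\<close> beats the growth of \<open>h\<close>; an
    order below pi/(b - a) keeps the cosine positive on the closed strip.\<close>
  obtain \<rho> where \<rho>: "\<sigma> < \<rho>" "\<rho> * (b - a) < pi"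
    using dense[of \<sigma> "pi / (b - a)"] \<sigma> ab by (auto simp: field_simps)
  define m where "m = (a + b) / 2"
  \<comment> \<open>The minimum of the cosine over the strip, attained on both edges.\<close>
  define \<delta> where "\<delta> = cos (\<rho> * (b - a) / 2)"
  have \<delta>: "\<delta> > 0" unfolding \<delta>_def using \<rho> \<sigma> ab by (intro cos_gt_zero_pi) (auto intro: less_trans[of _ 0])
  have cosge: "cos (\<rho> * (y - m)) \<ge> \<delta>" if "y \<in> {a..b}" for y
  proof -
    have "\<bar>y - m\<bar> \<le> (b - a) / 2" using that by (auto simp: m_def abs_if field_simps)
    then have "\<rho> * \<bar>y - m\<bar> \<le> \<rho> * (b - a) / 2" using mult_left_mono[of "\<bar>y - m\<bar>" "(b - a) / 2" \<rho>] \<rho> \<sigma> by simp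
    then have "cos (\<rho> * \<bar>y - m\<bar>) \<ge> \<delta>" unfolding \<delta>_def using \<rho> \<sigma>
      by (intro cos_monotone_0_pi_le) (auto, use \<rho>(2) pi_gt_zero in linarith)
    then show ?thesis using \<rho> \<sigma> by (simp add: abs_if split: if_splits) (metis cos_minus mult_minus_right minus_diff_eq)
  qed
  have ne: "cmod (exp (- complex_of_real \<epsilon> * exp (\<rho> * (t - \<i> * m)))) = exp (- \<epsilon> * (exp (\<rho> * Re t) * cos (\<rho> * (Im t - m))))"
    for \<epsilon> t by (simp add: Re_exp)
  have main: "cmod (h t) * exp (- \<epsilon> * (exp (\<rho> * Re t) * cos (\<rho> * (Im t - m)))) \<le> M" if \<epsilon>: "\<epsilon> > 0" for \<epsilon>
  proof -
    define g where "g = (\<lambda>t. h t * exp (- complex_of_real \<epsilon> * exp (\<rho> * (t - \<i> * m))))"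
    have ng: "cmod (g t) = cmod (h t) * exp (- \<epsilon> * (exp (\<rho> * Re t) * cos (\<rho> * (Im t - m))))" for t
      unfolding g_def norm_mult ne ..
    have holg: "g holomorphic_on UNIV" unfolding g_def by (intro holomorphic_intros hol)
    have gh: "cmod (g t) \<le> cmod (h t)" if "Im t \<in> {a..b}" for t
      unfolding ng using cosge[OF that] \<epsilon> \<delta> by (intro mult_left_le) auto
    have "\<epsilon> * \<delta> > 0" using \<epsilon> \<delta> by simp
    then have "((\<lambda>x. exp (K' * exp (\<sigma> * x) - (\<epsilon> * \<delta>) * exp (\<rho> * x))) \<longlongrightarrow> 0) at_top"
      using exp_exp_dominated[of "K'" "\<epsilon> * \<delta>" \<sigma> "\<rho> - \<sigma>"] \<rho>(1) \<sigma>(1) K' by simp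
    from tendsto_mult_right_zero[OF this, of "\<bar>B\<bar>"]
    have "((\<lambda>x. \<bar>B\<bar> * exp (K' * exp (\<sigma> * x) - (\<epsilon> * \<delta>) * exp (\<rho> * x))) \<longlongrightarrow> 0) at_top" .
    then have "eventually (\<lambda>x. \<bar>B\<bar> * exp (K' * exp (\<sigma> * x) - (\<epsilon> * \<delta>) * exp (\<rho> * x)) < M) at_top"
      using M by (rule order_tendstoD)
    then obtain X0 where X0: "\<And>x. x \<ge> X0 \<Longrightarrow> \<bar>B\<bar> * exp (K' * exp (\<sigma> * x) - (\<epsilon> * \<delta>) * exp (\<rho> * x)) < M"
      by (auto simp: eventually_at_top_linorder)
    have right: "cmod (g t) \<le> M" if "Im t \<in> {a..b}" "Re t \<ge> X0" for t
    proof -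
      have "\<epsilon> * \<delta> * exp (\<rho> * Re t) \<le> \<epsilon> * (exp (\<rho> * Re t) * cos (\<rho> * (Im t - m)))"
        using cosge[OF that(1)] \<epsilon> by (simp add: mult.commute mult_left_mono)
      then have e: "exp (- \<epsilon> * (exp (\<rho> * Re t) * cos (\<rho> * (Im t - m)))) \<le> exp (- (\<epsilon> * \<delta>) * exp (\<rho> * Re t))" by simp
      have "B * exp (K * exp (\<sigma> * Re t)) \<le> \<bar>B\<bar> * exp (K' * exp (\<sigma> * Re t))"
        using K' by (intro mult_mono) auto
      then have "cmod (h t) \<le> \<bar>B\<bar> * exp (K' * exp (\<sigma> * Re t))" using growth[OF that(1)] by simp
      then have "cmod (g t) \<le> \<bar>B\<bar> * exp (K' * exp (\<sigma> * Re t)) * exp (- (\<epsilon> * \<delta>) * exp (\<rho> * Re t))"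
        unfolding ng using e by (intro mult_mono) auto
      also have "\<dots> \<le> M" using X0[OF that(2)] by (simp add: exp_diff exp_minus field_simps)
      finally show ?thesis .
    qed
    \<comment> \<open>The vertical sides lie where \<open>left\<close> and \<open>right\<close>
      apply, and \<open>t\<close> belongs to the rectangle wherever it sits in the strip.\<close>
    define S where "S = cbox (Complex (min L0 (Re t)) a) (Complex (max X0 (Re t)) b)"
    have "cmod (g t) \<le> M"
    proof (rule maximum_modulus_frontier[of g S])
      show "g holomorphic_on interior S" using holg by (rule holomorphic_on_subset) auto
      show "continuous_on (closure S) g" using holg by (meson holomorphic_on_imp_continuous_on holomorphic_on_subset subset_UNIV)
      show "bounded S" by (simp add: S_def)
      show "t \<in> S" using t by (simp add: S_def in_cbox_complex_iff)
      fix z assume "z \<in> frontier S"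
      then have z: "z \<in> S" "z \<notin> box (Complex (min L0 (Re t)) a) (Complex (max X0 (Re t)) b)"
        by (simp_all add: S_def frontier_cbox)
      then have zi: "Im z \<in> {a..b}" by (simp add: S_def in_cbox_complex_iff)
      from z consider "Re z \<le> L0" | "Re z \<ge> X0" | "Im z = a" | "Im z = b"
        by (fastforce simp: S_def in_cbox_complex_iff in_box_complex_iff)
      then show "cmod (g z) \<le> M"
        by cases (use gh[OF zi] left[OF zi] right[OF zi] top[of z] bottom[of z] in auto)
    qed
    then show ?thesis by (simp add: ng)
  qed
  \<comment> \<open>The bound holds for every positive \<open>\<epsilon>\<close>, so the damping
    disappears in the limit.\<close>
  have "((\<lambda>\<epsilon>. cmod (h t) * exp (- \<epsilon> * (exp (\<rho> * Re t) * cos (\<rho> * (Im t - m))))) \<longlongrightarrow> cmod (h t) * exp (- 0 * (exp (\<rho> * Re t) * cos (\<rho> * (Im t - m))))) (at_right 0)"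
    by (intro tendsto_intros)
  then have "((\<lambda>\<epsilon>. cmod (h t) * exp (- \<epsilon> * (exp (\<rho> * Re t) * cos (\<rho> * (Im t - m))))) \<longlongrightarrow> cmod (h t)) (at_right 0)"
    by simp
  then show ?thesis
    by (rule tendsto_upperbound) (use main in \<open>auto simp: eventually_at_right_field intro: exI[of _ 1]\<close>)
qed

text \<open>The opening angle pi/2 is critical for growth of order 2, so Phragmen-Lindelof does not apply
  to the quadrant itself. On the sector between the angles \<open>\<theta>\<close> and pi/2 the factor
  exp (i A z^2) with A = (k/2) tan \<open>\<theta>\<close> exactly cancels the growth on the lower ray, and
  A tends to 0 with \<open>\<theta>\<close>.\<close>

lemma bounded_on_quadrant:
  fixes f :: "complex \<Rightarrow> complex"
  assumes hol: "f holomorphic_on UNIV" and k: "k \<ge> 0"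
    and bd: "\<And>z. cmod (f z) \<le> C * exp (k * min ((Re z)\<^sup>2) ((Im z)\<^sup>2))"
    and z: "Re z > 0" "Im z > 0"
  shows "cmod (f z) \<le> C + 1"
proof -
  have C: "C \<ge> 0" using order_trans[OF norm_ge_zero bd[of 0]] by simp
  \<comment> \<open>In the coordinate \<open>t\<close> the argument of \<open>z\<close> becomes the
    height: sectors become strips, and the vertex 0 moves to the far left.\<close>
  define t where "t = Ln z"
  have et: "exp t = z" using z by (cases "z = 0") (auto simp: t_def)
  have it: "0 < Im t" "Im t < pi / 2"
    using z Im_Ln_pos_lt_imp[of z] Re_Ln_pos_lt_imp[of z] by (auto simp: t_def)
  \<comment> \<open>Continuity at 0 supplies the bound at the left end; the summand 1 in
    \<open>C + 1\<close> comes from here.\<close>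
  have "isCont f 0" using hol by (metis UNIV_I continuous_on_eq_continuous_at holomorphic_on_imp_continuous_on open_UNIV)
  then obtain d where d: "d > 0" "\<And>w. cmod w < d \<Longrightarrow> cmod (f w - f 0) < 1"
    unfolding continuous_at_eps_delta by (metis dist_norm diff_zero zero_less_one)
  have small: "cmod (f w) \<le> C + 1" if "cmod w < d" for w
    using d(2)[OF that] bd[of 0] norm_triangle_ineq2[of "f w" "f 0"] by simp
  have main: "cmod (f z) * exp (- (k / 2 * tan \<theta>) * (exp (2 * Re t) * sin (2 * Im t))) \<le> C + 1"
    if \<theta>: "0 < \<theta>" "\<theta> < Im t" for \<theta>
  proof -
    define A where "A = k / 2 * tan \<theta>"
    have A: "A \<ge> 0" using tan_gt_zero[of \<theta>] \<theta> it k by (simp add: A_def)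
    have As: "A * sin (2 * \<theta>) = k * (sin \<theta>)\<^sup>2"
      using cos_gt_zero_pi[of \<theta>] \<theta> it by (simp add: A_def tan_def sin_double power2_eq_square)
    define h where "h = (\<lambda>t. f (exp t) * exp (\<i> * A * exp (2 * t)))"
    have nh: "cmod (h t) = cmod (f (exp t)) * exp (- A * (exp (2 * Re t) * sin (2 * Im t)))" for t
      unfolding h_def by (simp add: norm_mult Im_exp)
    have sq: "(Re (exp t))\<^sup>2 = exp (2 * Re t) * (cos (Im t))\<^sup>2" "(Im (exp t))\<^sup>2 = exp (2 * Re t) * (sin (Im t))\<^sup>2" for t
      by (simp_all add: Re_exp Im_exp power_mult_distrib exp_double)
    have le: "cmod (h t) \<le> cmod (f (exp t))" if "Im t \<in> {\<theta>..pi/2}" for t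
    proof -
      have "sin (2 * Im t) \<ge> 0" using that \<theta> by (intro sin_ge_zero) auto
      then show ?thesis unfolding nh using A by (intro mult_left_le) auto
    qed
    have "cmod (h t) \<le> C + 1"
    \<comment> \<open>Growth of order 2 in \<open>z\<close> becomes \<open>\<sigma>\<close> = 2, and
      \<open>\<theta>\<close> > 0 makes the width strictly less than the critical pi/2. For
      \<open>Re t\<close> up to \<open>ln d - 1\<close> the point \<open>exp t\<close> has modulus
      below \<open>d\<close>.\<close>
    proof (rule phragmen_lindelof_strip[where h = h and t = t and a = \<theta> and b = "pi/2" and \<sigma> = 2 and ?L0.0 = "ln d - 1" and B = C and K = k])
      have "(f \<circ> exp) holomorphic_on UNIV" by (intro holomorphic_on_compose_gen[OF _ hol] holomorphic_intros) auto
      then show "h holomorphic_on UNIV" unfolding h_def o_def by (intro holomorphic_intros)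
      show "2 * (pi / 2 - \<theta>) < pi" using \<theta> by simp
      show "C + 1 > 0" using C by simp
      show "Im t \<in> {\<theta>..pi/2}" using \<theta> it by simp
    next
      fix t assume t: "Im t = \<theta>"
      have "cmod (f (exp t)) \<le> C * exp (k * min ((Re (exp t))\<^sup>2) ((Im (exp t))\<^sup>2))" by (rule bd)
      also have "\<dots> \<le> C * exp (k * (Im (exp t))\<^sup>2)" using C k by (intro mult_left_mono) (auto intro: mult_left_mono)
      also have "k * (Im (exp t))\<^sup>2 = A * (exp (2 * Re t) * sin (2 * Im t))"
        using As by (simp add: sq t)
      finally have "cmod (h t) \<le> C" unfolding nh by (simp add: exp_minus field_simps)
      then show "cmod (h t) \<le> C + 1" by simp
    next
      \<comment> \<open>On the imaginary axis the minimum is 0 and the correcting factor has modulus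
        1, so no growth remains.\<close>
      fix t assume t: "Im t = pi / 2"
      then have "2 * Im t = pi" by simp
      then have "cmod (h t) = cmod (f (exp t))" unfolding nh by (simp only: sin_pi) simp
      also have "\<dots> \<le> C * exp (k * min ((Re (exp t))\<^sup>2) ((Im (exp t))\<^sup>2))" by (rule bd)
      also have "(Re (exp t))\<^sup>2 = 0" by (simp add: sq t)
      finally show "cmod (h t) \<le> C + 1" by (simp add: min_def)
    next
      fix t assume t: "Im t \<in> {\<theta>..pi/2}" "Re t \<le> ln d - 1"
      have "exp (Re t) < exp (ln d)" using t(2) by simp
      then have "cmod (exp t) < d" using d by simp
      then show "cmod (h t) \<le> C + 1" using small le[OF t(1)] by fastforce
    next
      fix t assume t: "Im t \<in> {\<theta>..pi/2}"
      have "(Im (exp t))\<^sup>2 \<le> exp (2 * Re t)" unfolding sq by (simp add: mult_left_le abs_square_le_1)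
      then have "k * min ((Re (exp t))\<^sup>2) ((Im (exp t))\<^sup>2) \<le> k * exp (2 * Re t)" using k by (intro mult_left_mono) auto
      then have "C * exp (k * min ((Re (exp t))\<^sup>2) ((Im (exp t))\<^sup>2)) \<le> C * exp (k * exp (2 * Re t))"
        using C by (intro mult_left_mono) auto
      then show "cmod (h t) \<le> C * exp (k * exp (2 * Re t))"
        using le[OF t] bd[of "exp t"] by linarith
    qed simp
    then show ?thesis unfolding nh et A_def .
  qed
  have "((\<lambda>\<theta>. cmod (f z) * exp (- (k / 2 * tan \<theta>) * (exp (2 * Re t) * sin (2 * Im t)))) \<longlongrightarrow>
     cmod (f z) * exp (- (k / 2 * tan 0) * (exp (2 * Re t) * sin (2 * Im t)))) (at_right 0)"
    by (intro tendsto_intros) auto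
  then have "((\<lambda>\<theta>. cmod (f z) * exp (- (k / 2 * tan \<theta>) * (exp (2 * Re t) * sin (2 * Im t)))) \<longlongrightarrow> cmod (f z)) (at_right 0)"
    by simp
  then show ?thesis
    by (rule tendsto_upperbound) (use main it in \<open>auto simp: eventually_at_right_field intro: exI[of _ "Im t"]\<close>)
qed

text \<open>Multiplication by i exchanges the squares of the real and imaginary parts, so the
  hypothesis is invariant under quarter turns and one quadrant settles all four. On the axes the
  minimum vanishes. Thus \<open>f\<close> is bounded, and Liouville applies.\<close>

lemma entire_gaussian_min_bound_constant:
  fixes f :: "complex \<Rightarrow> complex"
  assumes hol: "f holomorphic_on UNIV" and k: "k \<ge> 0"
    and bd: "\<And>z. cmod (f z) \<le> C * exp (k * min ((Re z)\<^sup>2) ((Im z)\<^sup>2))"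
  shows "f z = f 0"
proof -
  have rot: "cmod (f (c * w)) \<le> C + 1" if c: "c \<in> {1, \<i>, -1, -\<i>}" and w: "Re w > 0" "Im w > 0" for c w
  proof (rule bounded_on_quadrant[where f = "\<lambda>w. f (c * w)" and k = k])
    have "(f \<circ> (\<lambda>w. c * w)) holomorphic_on UNIV" by (intro holomorphic_on_compose_gen[OF _ hol] holomorphic_intros) auto
    then show "(\<lambda>w. f (c * w)) holomorphic_on UNIV" by (simp add: o_def)
    show "cmod (f (c * z)) \<le> C * exp (k * min ((Re z)\<^sup>2) ((Im z)\<^sup>2))" for z
      using bd[of "c * z"] c by (auto simp: min.commute)
  qed (use k w in auto)
  have "cmod (f z) \<le> C + 1" for z
  proof -
    consider "Re z = 0 \<or> Im z = 0" | "Re z > 0" "Im z > 0" | "Re z < 0" "Im z > 0" | "Re z < 0" "Im z < 0" | "Re z > 0" "Im z < 0"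
      by linarith
    then show ?thesis
    proof cases
      case 1
      then have "min ((Re z)\<^sup>2) ((Im z)\<^sup>2) = 0" by (auto simp: min_def)
      then show ?thesis using bd[of z] by simp
    next
      case 2 then show ?thesis using rot[of 1 z] by simp
    next
      case 3 then show ?thesis using rot[of "\<i>" "-\<i> * z"] by (simp flip: mult.assoc)
    next
      case 4 then show ?thesis using rot[of "-1" "-z"] by simp
    next
      case 5 then show ?thesis using rot[of "-\<i>" "\<i> * z"] by (simp flip: mult.assoc)
    qed
  qed
  then have "bounded (range f)" by (auto simp: bounded_iff)
  then have "f constant_on UNIV" using Liouville_theorem hol by blast
  then show ?thesis by (metis constant_on_def UNIV_I)
qed

section \<open>The Hermitian form and rotation averages\<close>

text \<open>The sesquilinear form with exp (herm lam p q) the reproducing kernel (up to a constant) and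
  exp (- herm lam p p) the weight.\<close>

definition herm :: "real \<Rightarrow> 'n::finite cvec2 \<Rightarrow> 'n cvec2 \<Rightarrow> complex" where
  "herm lam p q = of_real (lam * coth lam / 2) * (cdot (fst p) (fst q) + cdot (snd p) (snd q))
     - \<i> / 2 * of_real lam * (cdot (snd p) (fst q) - cdot (fst p) (snd q))"

definition vcnj2 :: "'n::finite cvec2 \<Rightarrow> 'n cvec2" where
  "vcnj2 q = (vcnj (fst q), vcnj (snd q))"

section \<open>Algebra of the Hermitian form and of complex scaling\<close>

lemma cdot_simps:
  "cdot (x + y) a = cdot x a + cdot y a" "cdot a (x + y) = cdot a x + cdot a y"
  "cdot (\<chi> j. c * x $ j) a = c * cdot x a" "cdot a (\<chi> j. c * x $ j) = cnj c * cdot a x"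
  by (simp_all add: cdot_def algebra_simps sum.distrib sum_distrib_left)

lemma cnj_cdot: "cnj (cdot x y) = cdot y x"
  by (simp add: cdot_def mult.commute)

lemma herm_add_left: "herm lam (p + p') q = herm lam p q + herm lam p' q"
  and herm_add_right: "herm lam q (p + p') = herm lam q p + herm lam q p'"
  and herm_cscale_left: "herm lam (cscale2 c p) q = c * herm lam p q"
  and herm_cscale_right: "herm lam p (cscale2 c q) = cnj c * herm lam p q"
  by (simp_all add: herm_def cdot_simps cscale2_def algebra_simps)

lemma cnj_herm: "cnj (herm lam p q) = herm lam q p"
  by (simp add: herm_def cnj_cdot algebra_simps)

lemma cscale2_add: "cscale2 (a + b) v = cscale2 a v + cscale2 b v"
  and cscale2_add_right: "cscale2 c (v + w) = cscale2 c v + cscale2 c w"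
  and cscale2_scaleR: "cscale2 c (r *\<^sub>R v) = r *\<^sub>R cscale2 c v"
  and scaleR_cscale2: "cscale2 (r *\<^sub>R c) v = r *\<^sub>R cscale2 c v"
  and cscale2_0: "cscale2 0 v = 0" "cscale2 c 0 = 0"
  and cscale2_1: "cscale2 1 v = v"
  and cscale2_minus: "cscale2 (- 1) v = - v"
  and cscale2_minus_right: "cscale2 c (- v) = - cscale2 c v"
  and vcnj2_cscale2: "vcnj2 (cscale2 c v) = cscale2 (cnj c) (vcnj2 v)"
  and vcnj2_add: "vcnj2 (v + w) = vcnj2 v + vcnj2 w"
  and vcnj2_0: "vcnj2 0 = 0"
  by (simp_all add: cscale2_def vcnj2_def vcnj_def prod_eq_iff vec_eq_iff algebra_simps)

lemma herm_0 [simp]: "herm lam 0 q = 0" "herm lam p 0 = 0"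
  using herm_cscale_left[of lam 0 0 q] herm_cscale_right[of lam p 0 0] by (simp_all add: cscale2_0)

lemma herm_minus: "herm lam (- p) q = - herm lam p q" "herm lam p (- q) = - herm lam p q"
  using herm_cscale_left[of lam "- 1" p q] herm_cscale_right[of lam p "- 1" q] by (simp_all add: cscale2_minus)

lemma herm_diff: "herm lam (p - p') q = herm lam p q - herm lam p' q" "herm lam q (p - p') = herm lam q p - herm lam q p'"
  using herm_add_left[of lam p "- p'" q] herm_add_right[of lam q p "- p'"] by (simp_all add: herm_minus)

lemma herm_diag_real: "of_real (Re (herm lam p p)) = herm lam p p"
  using cnj_herm[of lam p p] by (metis of_real_Re complex_In_mult_cnj_zero Reals_cnj_iff)

lemma Re_herm_diff: "Re (herm lam (p - u) (p - u)) = Re (herm lam p p) + Re (herm lam u u) - 2 * Re (herm lam p u)"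
  using arg_cong[OF cnj_herm[of lam p u], of Re] by (simp add: herm_diff)

lemma Re_herm_add: "Re (herm lam (p + u) (p + u)) = Re (herm lam p p) + Re (herm lam u u) + 2 * Re (herm lam p u)"
  using Re_herm_diff[of lam p "- u"] by (simp add: herm_minus)

lemma cdot_self: "cdot z z = of_real (cnorm2 z)"
  unfolding cdot_def cnorm2_def of_real_sum complex_norm_square ..

lemma Re_herm_diag: "Re (herm lam p p) = lam * coth lam / 2 * (cnorm2 (fst p) + cnorm2 (snd p)) - lam * Im (cdot (fst p) (snd p))"
  unfolding herm_def using cnj_cdot[of "fst p" "snd p", symmetric] by (simp add: cdot_self)

lemma wlam_eq: "wlam lam p = exp (- Re (herm lam p p))"
  unfolding wlam_def Re_herm_diag exp_add[symmetric] by (simp add: algebra_simps)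

section \<open>Positive definiteness of the form\<close>

lemma norm_cvec2: "(norm p)\<^sup>2 = cnorm2 (fst p) + cnorm2 (snd p)" for p :: "'n::finite cvec2"
proof -
  have "cnorm2 z = (norm z)\<^sup>2" for z :: "complex^'n"
    by (simp add: norm_vec_def L2_set_def cnorm2_def sum_nonneg)
  then show ?thesis by (simp add: norm_prod_def)
qed

lemma abs_Im_cdot_le: "\<bar>Im (cdot z w)\<bar> \<le> (cnorm2 z + cnorm2 w) / 2"
proof -
  have "\<bar>Im (cdot z w)\<bar> \<le> cmod (cdot z w)" by (rule abs_Im_le_cmod)
  also have "\<dots> \<le> (\<Sum>j\<in>UNIV. cmod (z $ j) * cmod (w $ j))"
    unfolding cdot_def by (rule order_trans[OF norm_sum]) (simp add: norm_mult)
  also have "\<dots> \<le> (\<Sum>j\<in>UNIV. ((cmod (z $ j))\<^sup>2 + (cmod (w $ j))\<^sup>2) / 2)"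
  proof (rule sum_mono)
    fix j show "cmod (z $ j) * cmod (w $ j) \<le> ((cmod (z $ j))\<^sup>2 + (cmod (w $ j))\<^sup>2) / 2"
      using sum_squares_bound[of "cmod (z $ j)" "cmod (w $ j)"] by simp
  qed
  also have "\<dots> = (cnorm2 z + cnorm2 w) / 2"
    by (simp add: cnorm2_def sum.distrib sum_divide_distrib[symmetric])
  finally show ?thesis .
qed

text \<open>Both sides are even in \<open>lam\<close>, and for positive \<open>lam\<close> the claim
  is sinh < cosh. Strictness makes the form positive definite and the weight integrable.\<close>

lemma mult_coth_gt_abs:
  assumes "lam \<noteq> 0" shows "\<bar>lam\<bar> < lam * coth lam"
proof -
  have pos: "x < x * coth x" if "x > 0" for x
  proof -
    have "sinh x > 0" "sinh x < cosh x" using that sinh_less_cosh_real by auto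
    then show ?thesis using that by (simp add: coth_def field_simps)
  qed
  have "lam * coth lam = \<bar>lam\<bar> * coth \<bar>lam\<bar>" by (simp add: coth_def abs_if)
  then show ?thesis using pos[of "\<bar>lam\<bar>"] assms by simp
qed

text \<open>By \<open>abs_Im_cdot_le\<close> the twisted term costs at most |lam|/2 times the
  squared norm. The remaining coefficient is positive for nonzero \<open>lam\<close>, by
  \<open>mult_coth_gt_abs\<close>.\<close>

lemma Re_herm_ge: "Re (herm lam p p) \<ge> (lam * coth lam - \<bar>lam\<bar>) / 2 * (norm p)\<^sup>2"
proof -
  have "lam * Im (cdot (fst p) (snd p)) \<le> \<bar>lam\<bar> * \<bar>Im (cdot (fst p) (snd p))\<bar>"
    by (metis abs_ge_self abs_mult)
  also have "\<dots> \<le> \<bar>lam\<bar> * ((cnorm2 (fst p) + cnorm2 (snd p)) / 2)"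
    by (intro mult_left_mono abs_Im_cdot_le) auto
  finally show ?thesis unfolding Re_herm_diag norm_cvec2
    by (simp add: left_diff_distrib diff_divide_distrib)
qed

lemma bounded_linear_herm: "bounded_linear (\<lambda>q. herm lam q u)"
proof -
  have "herm lam (r *\<^sub>R q) u = r *\<^sub>R herm lam q u" for r q
    using scaleR_cscale2[of r 1 q] herm_cscale_left[of lam "r *\<^sub>R 1" q u]
    by (simp add: cscale2_1 scaleR_conv_of_real)
  then show ?thesis unfolding linear_conv_bounded_linear[symmetric]
    by (intro linearI) (auto simp: herm_add_left)
qed

section \<open>Continuity, restriction to complex lines, and averages over rotations\<close>

lemma continuous_on_cdot [continuous_intros]:
  "continuous_on S f \<Longrightarrow> continuous_on S g \<Longrightarrow> continuous_on S (\<lambda>x. cdot (f x) (g x))"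
  unfolding cdot_def by (intro continuous_intros)

lemma continuous_on_herm [continuous_intros]:
  "continuous_on S f \<Longrightarrow> continuous_on S g \<Longrightarrow> continuous_on S (\<lambda>x. herm lam (f x) (g x))"
  unfolding herm_def by (intro continuous_intros)

lemma continuous_on_cscale2 [continuous_intros]:
  "continuous_on S c \<Longrightarrow> continuous_on S g \<Longrightarrow> continuous_on S (\<lambda>x. cscale2 (c x) (g x))"
  unfolding cscale2_def by (intro continuous_intros)

lemma continuous_on_vcnj2 [continuous_intros]:
  "continuous_on S g \<Longrightarrow> continuous_on S (\<lambda>x. vcnj2 (g x))"
  unfolding vcnj2_def vcnj_def by (intro continuous_intros)

lemma continuous_on_wlam: "continuous_on S (wlam lam)"
  unfolding wlam_eq[abs_def] by (intro continuous_intros)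

lemma entire2_continuous_on: "entire2 F \<Longrightarrow> continuous_on S F"
  by (meson continuous_at_imp_continuous_on entire2_def has_derivative_continuous)

text \<open>Complex homogeneity of the derivative in \<open>entire2\<close> turns the chain rule
  into complex differentiability. Through this restriction one-variable theory suffices
  throughout.\<close>

lemma entire2_holomorphic_line:
  assumes "entire2 F"
  shows "(\<lambda>\<zeta>. F (a + cscale2 \<zeta> v)) holomorphic_on UNIV"
proof -
  have "\<exists>D. ((\<lambda>\<zeta>. F (a + cscale2 \<zeta> v)) has_field_derivative D) (at \<zeta>)" for \<zeta>
  proof -
    obtain L where L: "(F has_derivative L) (at (a + cscale2 \<zeta> v))" "\<And>c v. L (cscale2 c v) = c * L v"
      using assms unfolding entire2_def by metis
    have "linear (\<lambda>\<zeta>. cscale2 \<zeta> v)" by (intro linearI) (auto simp: cscale2_add scaleR_cscale2)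
    then have "bounded_linear (\<lambda>\<zeta>. cscale2 \<zeta> v)" by (simp add: linear_conv_bounded_linear)
    then have "((\<lambda>\<zeta>. a + cscale2 \<zeta> v) has_derivative (\<lambda>h. 0 + cscale2 h v)) (at \<zeta>)"
      by (intro has_derivative_add has_derivative_const bounded_linear_imp_has_derivative)
    from has_derivative_compose[OF this L(1)]
    have "((\<lambda>\<zeta>. F (a + cscale2 \<zeta> v)) has_derivative (\<lambda>h. L v * h)) (at \<zeta>)"
      by (simp add: L(2) mult.commute)
    then show ?thesis unfolding has_field_derivative_def by blast
  qed
  then show ?thesis unfolding holomorphic_on_def field_differentiable_def by (auto intro: has_field_derivative_at_within)
qed

lemma linear_cscale2: "linear (cscale2 c)"
  by (intro linearI) (auto simp: cscale2_add_right cscale2_scaleR)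

lemma norm_cscale2_cis: "norm (cscale2 (cis \<theta>) v) = norm v"
proof -
  have "(norm (cscale2 (cis \<theta>) v))\<^sup>2 = (norm v)\<^sup>2"
    unfolding norm_cvec2 by (simp add: cscale2_def cnorm2_def norm_mult)
  then show ?thesis by simp
qed

text \<open>A rotation preserves both Lebesgue measure and \<open>\<psi>\<close>, so rotating the
  argument of \<open>g\<close> leaves the integral unchanged. Averaging over the angle and
  exchanging the integrals leaves circle means of \<open>g\<close> on complex lines through 0, all
  equal to \<open>g 0\<close>.\<close>

lemma integral_rotation_mean_value:
  fixes g :: "'n::finite cvec2 \<Rightarrow> complex" and \<psi> :: "'n cvec2 \<Rightarrow> real"
  assumes contg: "continuous_on UNIV g" and hol: "\<And>v. (\<lambda>\<zeta>. g (cscale2 \<zeta> v)) holomorphic_on UNIV"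
    and cont\<psi>: "continuous_on UNIV \<psi>" and rot: "\<And>\<theta> v. \<psi> (cscale2 (cis \<theta>) v) = \<psi> v"
    and int: "integrable lborel (\<lambda>v. g v * \<psi> v)"
  shows "(\<integral>v. g v * \<psi> v \<partial>lborel) = g 0 * of_real (\<integral>v. \<psi> v \<partial>lborel)"
proof -
  let ?r = "\<lambda>t. cscale2 (cis (2 * pi * t))"
  let ?G = "\<lambda>t v. indicator {0..1::real} t *\<^sub>R (g (?r t v) * \<psi> v)"
  have meas: "(\<lambda>v. g v * \<psi> v) \<in> borel_measurable borel"
    by (intro borel_measurable_continuous_onI continuous_intros contg cont\<psi>)
  have rint: "integrable lborel (\<lambda>v. g (?r t v) * \<psi> v)"
    and rnorm: "(\<integral>v. norm (g (?r t v) * \<psi> v) \<partial>lborel) = (\<integral>v. norm (g v * \<psi> v) \<partial>lborel)"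
    and rval: "(\<integral>v. g (?r t v) * \<psi> v \<partial>lborel) = (\<integral>v. g v * \<psi> v \<partial>lborel)" for t
    using integrable_lborel_linear_isometry[OF linear_cscale2 norm_cscale2_cis meas] int
      integral_lborel_linear_isometry[OF linear_cscale2 norm_cscale2_cis meas]
      integral_lborel_linear_isometry[OF linear_cscale2 norm_cscale2_cis measurable_compose[OF meas borel_measurable_norm]]
    by (simp_all add: rot)
  have "(\<lambda>p. g (?r (fst p) (snd p)) * \<psi> (snd p)) \<in> borel_measurable borel"
    by (intro borel_measurable_continuous_onI continuous_intros continuous_on_compose2[OF contg]
        continuous_on_compose2[OF cont\<psi>]) auto
  moreover have "{0..1::real} \<times> (UNIV :: 'n cvec2 set) \<in> sets borel"
    by (intro borel_closed closed_Times) auto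
  ultimately have "(\<lambda>p. indicator ({0..1::real} \<times> (UNIV :: 'n cvec2 set)) p *\<^sub>R (g (?r (fst p) (snd p)) * \<psi> (snd p))) \<in> borel_measurable borel"
    by (intro borel_measurable_scaleR borel_measurable_indicator)
  also have "(\<lambda>p. indicator ({0..1::real} \<times> (UNIV :: 'n cvec2 set)) p *\<^sub>R (g (?r (fst p) (snd p)) * \<psi> (snd p))) = case_prod ?G"
    by (auto simp: fun_eq_iff indicator_def)
  finally have mG: "case_prod ?G \<in> borel_measurable (lborel \<Otimes>\<^sub>M lborel)"
    by (simp add: lborel_prod)
  have "integrable (lborel \<Otimes>\<^sub>M lborel) (case_prod ?G)"
  proof (rule lborel_pair.Fubini_integrable[OF mG])
    show "AE t in lborel. integrable lborel (\<lambda>v. case_prod ?G (t, v))"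
      using rint by simp
    \<comment> \<open>Rotation invariance makes the inner integral of the norm independent of
      \<open>t\<close>, so only a constant on [0,1] has to be integrated.\<close>
    have "integrable lborel (\<lambda>t. indicator {0..1::real} t * (\<integral>v. norm (g v * \<psi> v) \<partial>lborel))"
      by (intro integrable_mult_left) simp
    also have "(\<lambda>t. indicator {0..1::real} t * (\<integral>v. norm (g v * \<psi> v) \<partial>lborel)) = (\<lambda>t. \<integral>v. norm (case_prod ?G (t, v)) \<partial>lborel)"
      using rnorm by (simp add: fun_eq_iff)
    finally show "integrable lborel (\<lambda>t. \<integral>v. norm (case_prod ?G (t, v)) \<partial>lborel)" .
  qed
  then have "(\<integral>v. (\<integral>t. ?G t v \<partial>lborel) \<partial>lborel) = (\<integral>t. (\<integral>v. ?G t v \<partial>lborel) \<partial>lborel)"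
    by (rule lborel_pair.Fubini_integral)
  also have "(\<lambda>v. \<integral>t. ?G t v \<partial>lborel) = (\<lambda>v. g 0 * \<psi> v)"
  proof
    fix v
    have "(\<integral>t. ?G t v \<partial>lborel) = (LINT t:{0..1}|lborel. g (?r t v)) * \<psi> v"
      unfolding set_lebesgue_integral_def by (subst integral_mult_left_zero[symmetric]) simp
    also have "(LINT t:{0..1}|lborel. g (?r t v)) = g 0"
      using circle_mean_value[OF hol[of v]] by (simp add: cscale2_0)
    finally show "(\<integral>t. ?G t v \<partial>lborel) = g 0 * \<psi> v" .
  qed
  also have "(\<lambda>t. \<integral>v. ?G t v \<partial>lborel) = (\<lambda>t. indicator {0..1} t *\<^sub>R (\<integral>v. g v * \<psi> v \<partial>lborel))"
    using rval by (simp add: fun_eq_iff)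
  also have "(\<integral>v. g 0 * \<psi> v \<partial>lborel) = g 0 * of_real (\<integral>v. \<psi> v \<partial>lborel)"
    by simp
  also have "(\<integral>t. indicator {0..1::real} t *\<^sub>R (\<integral>v. g v * \<psi> v \<partial>lborel) \<partial>lborel) = (\<integral>v. g v * \<psi> v \<partial>lborel)"
    by (subst integral_scaleR_left) auto
  finally show ?thesis by simp
qed

section \<open>The Fock space\<close>

lemma borel_measurable_wlam: "wlam lam \<in> borel_measurable borel"
  by (intro borel_measurable_continuous_onI continuous_on_wlam)

lemma wlam_rotate: "wlam lam (cscale2 (cis \<theta>) v) = wlam lam v"
  by (simp add: wlam_eq herm_cscale_left herm_cscale_right cis_cnj cis_mult flip: mult.assoc)

lemma integrable_wlam:
  assumes "lam \<noteq> 0"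
  shows "integrable lborel (wlam lam :: 'n::finite cvec2 \<Rightarrow> real)"
proof (rule Bochner_Integration.integrable_bound)
  have "(lam * coth lam - \<bar>lam\<bar>) / 2 > 0" using mult_coth_gt_abs[OF assms] by simp
  from integrable_gaussian[OF this]
  show "integrable lborel (\<lambda>p::'n cvec2. exp (- ((lam * coth lam - \<bar>lam\<bar>) / 2) * (norm p)\<^sup>2))" .
  show "AE p in lborel. norm (wlam lam (p::'n cvec2)) \<le> norm (exp (- ((lam * coth lam - \<bar>lam\<bar>) / 2) * (norm p)\<^sup>2))"
    by (rule AE_I2) (use Re_herm_ge[of lam] in \<open>simp add: wlam_eq\<close>)
qed (simp add: borel_measurable_wlam)

lemma integral_wlam_pos:
  assumes "lam \<noteq> 0"
  shows "(\<integral>p. wlam lam (p :: 'n::finite cvec2) \<partial>lborel) > 0"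
proof -
  have nn: "wlam lam p \<ge> 0" for p :: "'n cvec2" by (simp add: wlam_eq)
  have "(\<integral>p. wlam lam (p :: 'n cvec2) \<partial>lborel) \<noteq> 0"
  proof
    assume "(\<integral>p. wlam lam (p :: 'n cvec2) \<partial>lborel) = 0"
    then have "AE p in (lborel :: 'n cvec2 measure). wlam lam p = 0"
      using integral_nonneg_eq_0_iff_AE[OF integrable_wlam[OF assms] AE_I2[OF nn]] by simp
    then have "AE p in (lborel :: 'n cvec2 measure). False" by (simp add: wlam_eq)
    then have "emeasure (lborel :: 'n cvec2 measure) UNIV = 0"
      by (subst (asm) AE_iff_measurable[of UNIV]) auto
    then show False by simp
  qed
  moreover have "(\<integral>p. wlam lam (p :: 'n cvec2) \<partial>lborel) \<ge> 0" using nn by (intro Bochner_Integration.integral_nonneg) auto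
  ultimately show ?thesis by simp
qed

text \<open>The usual bound of a point value by the kernel on the diagonal. Moving \<open>p\<close>
  to the origin multiplies the weight by exp (-H(p,p)) |exp (-H(v,p))|^2; the second factor is
  absorbed into a holomorphic function of v, to which the rotation average applies.\<close>

lemma fock_evaluation_bound:
  fixes F :: "'n::finite cvec2 \<Rightarrow> complex"
  assumes "F \<in> fock lam"
  shows "(cmod (F p))\<^sup>2 * (\<integral>v. wlam lam (v :: 'n cvec2) \<partial>lborel)
    \<le> exp (Re (herm lam p p)) * (\<integral>q. (cmod (F q))\<^sup>2 * wlam lam q \<partial>lborel)"
proof -
  have ent: "entire2 F" and int: "integrable lborel (\<lambda>q. (cmod (F q))\<^sup>2 * wlam lam q)"
    using assms by (auto simp: fock_def)
  \<comment> \<open>Squaring F makes the mean value property give the L2 bound directly, without Cauchy-Schwarz.\<close>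
  define g where "g = (\<lambda>v. (F (p + v) * exp (- herm lam v p))\<^sup>2)"
  have cont: "continuous_on UNIV g" unfolding g_def
    by (intro continuous_intros continuous_on_compose2[OF entire2_continuous_on[OF ent, of UNIV]]) auto
  have hol: "(\<lambda>\<zeta>. g (cscale2 \<zeta> v)) holomorphic_on UNIV" for v
    unfolding g_def herm_cscale_left by (intro holomorphic_intros entire2_holomorphic_line[OF ent])
  have mF: "(\<lambda>q. (cmod (F q))\<^sup>2 * wlam lam q) \<in> borel_measurable borel"
    by (intro borel_measurable_continuous_onI continuous_intros entire2_continuous_on[OF ent] continuous_on_wlam)
  have norm_g: "norm (g v * wlam lam v) = exp (Re (herm lam p p)) * ((cmod (F (p + v)))\<^sup>2 * wlam lam (p + v))" for v
  proof -
    have "norm (g v * wlam lam v) = (cmod (F (p + v)))\<^sup>2 * ((exp (- Re (herm lam v p)))\<^sup>2 * exp (- Re (herm lam v v)))"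
      by (simp add: g_def norm_mult norm_power power_mult_distrib wlam_eq)
    also have "(exp (- Re (herm lam v p)))\<^sup>2 * exp (- Re (herm lam v v)) = exp (Re (herm lam p p)) * wlam lam (p + v)"
      using arg_cong[OF cnj_herm[of lam p v], of Re]
      by (simp add: wlam_eq Re_herm_add exp_double[symmetric] mult_exp_exp)
    finally show ?thesis by simp
  qed
  have mg: "(\<lambda>v. g v * wlam lam v) \<in> borel_measurable borel"
    by (intro borel_measurable_continuous_onI continuous_intros cont continuous_on_wlam)
  have "integrable lborel (\<lambda>v. norm (g v * wlam lam v))"
    unfolding norm_g using integrable_lborel_translate[OF mF, of p] int by simp
  then have intg: "integrable lborel (\<lambda>v. g v * wlam lam v)"
    using mg by (subst (asm) integrable_norm_iff) auto
  have "g 0 * of_real (\<integral>v. wlam lam (v :: 'n cvec2) \<partial>lborel) = (\<integral>v. g v * wlam lam v \<partial>lborel)"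
    by (rule integral_rotation_mean_value[symmetric])
      (use cont hol continuous_on_wlam wlam_rotate intg in auto)
  then have "cmod (g 0 * of_real (\<integral>v. wlam lam (v :: 'n cvec2) \<partial>lborel)) \<le> (\<integral>v. norm (g v * wlam lam v) \<partial>lborel)"
    by simp
  also have "(\<integral>v. norm (g v * wlam lam v) \<partial>lborel) = exp (Re (herm lam p p)) * (\<integral>v. (cmod (F (p + v)))\<^sup>2 * wlam lam (p + v) \<partial>lborel)"
    unfolding norm_g by simp
  also have "(\<integral>v. (cmod (F (p + v)))\<^sup>2 * wlam lam (p + v) \<partial>lborel) = (\<integral>q. (cmod (F q))\<^sup>2 * wlam lam q \<partial>lborel)"
    by (rule integral_lborel_translate[OF mF])
  also have "cmod (g 0 * of_real (\<integral>v. wlam lam (v :: 'n cvec2) \<partial>lborel)) = (cmod (F p))\<^sup>2 * \<bar>\<integral>v. wlam lam (v :: 'n cvec2) \<partial>lborel\<bar>"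
    by (simp add: g_def norm_mult norm_power)
  finally show ?thesis by (smt (verit) mult_left_mono zero_le_power2)
qed

section \<open>Reproducing kernels and their images under the operators\<close>

definition rkernel :: "real \<Rightarrow> 'n::finite cvec2 \<Rightarrow> 'n cvec2 \<Rightarrow> complex" where
  "rkernel lam u q = exp (herm lam q u)"

lemma entire2_rkernel: "entire2 (rkernel lam u)"
  unfolding entire2_def
proof
  fix p
  have "((\<lambda>q. herm lam q u) has_derivative (\<lambda>h. herm lam h u)) (at p)"
    by (rule bounded_linear_imp_has_derivative[OF bounded_linear_herm])
  then have "(rkernel lam u has_derivative (\<lambda>h. exp (herm lam p u) * herm lam h u)) (at p)"
    unfolding rkernel_def
    using has_derivative_compose[OF _ has_field_derivative_imp_has_derivative[OF DERIV_exp]] by blast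
  then show "\<exists>L. (rkernel lam u has_derivative L) (at p) \<and> (\<forall>c v. L (cscale2 c v) = c * L v)"
    by (intro exI conjI) (auto simp: herm_cscale_left)
qed

text \<open>Completing the square: |exp H(q,u)|^2 times the weight at q is exp H(u,u) times the
  weight at q - u. Translation invariance does the rest.\<close>

lemma rkernel_fock:
  fixes u :: "'n::finite cvec2"
  assumes "lam \<noteq> 0"
  shows "rkernel lam u \<in> fock lam"
    and "(\<integral>q. (cmod (rkernel lam u q))\<^sup>2 * wlam lam q \<partial>lborel)
       = exp (Re (herm lam u u)) * (\<integral>v. wlam lam (v :: 'n cvec2) \<partial>lborel)"
proof -
  have eq: "(cmod (rkernel lam u q))\<^sup>2 * wlam lam q = exp (Re (herm lam u u)) * wlam lam (- u + q)" for q
    using Re_herm_diff[of lam q u]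
    by (simp add: rkernel_def wlam_eq exp_double[symmetric] mult_exp_exp)
  show "rkernel lam u \<in> fock lam"
    unfolding fock_def mem_Collect_eq eq
    using integrable_lborel_translate[OF borel_measurable_wlam, of lam "- u"] integrable_wlam[OF assms]
    by (intro conjI entire2_rkernel integrable_mult_right) blast
  show "(\<integral>q. (cmod (rkernel lam u q))\<^sup>2 * wlam lam q \<partial>lborel)
       = exp (Re (herm lam u u)) * (\<integral>v. wlam lam (v :: 'n cvec2) \<partial>lborel)"
    unfolding eq using integral_lborel_translate[OF borel_measurable_wlam, of lam "- u"] by simp
qed

text \<open>The two exponentials of the operator combine into one; together with
  \<open>wlam_eq\<close>, a single form governs both kernel and weight.\<close>

lemma S_kernel_eq:
  "S_kernel lam s \<phi> F p q = F q * \<phi> (p - s *\<^sub>R vcnj2 q) * exp (herm lam p q) * wlam lam q"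
proof -
  have "herm lam p q = complex_of_real ((1/2) * lam * coth lam) * (cdot (fst p) (fst q) + cdot (snd p) (snd q))
     + - (\<i> / 2) * complex_of_real lam * (cdot (snd p) (fst q) - cdot (fst p) (snd q))"
    by (simp add: herm_def)
  then show ?thesis unfolding S_kernel_def Let_def
    by (simp only: exp_add) (simp add: vcnj2_def minus_prod_def)
qed

text \<open>After the shift q = u + v the exponent H(u+v,u) + H(p,u+v) - H(u+v,u+v) collapses to
  H(p,u) + H(p-u,v) - H(v,v). What remains is a constant, an antiholomorphic function of v and the
  weight at v, so the integral picks out the value at v = 0.\<close>

lemma S_op_rkernel:
  fixes \<phi> :: "'n::finite cvec2 \<Rightarrow> complex"
  assumes ent: "entire2 \<phi>" and int: "integrable lborel (S_kernel lam s \<phi> (rkernel lam u) p)"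
  shows "S_op lam s \<phi> (rkernel lam u) p
    = exp (herm lam p u) * \<phi> (p - s *\<^sub>R vcnj2 u) * of_real (\<integral>v. wlam lam (v :: 'n cvec2) \<partial>lborel)"
proof -
  define b where "b = p - s *\<^sub>R vcnj2 u"
  \<comment> \<open>The integrand is antiholomorphic in v, so the mean value property is applied to its conjugate.\<close>
  define g where "g = (\<lambda>v. cnj (\<phi> (b - s *\<^sub>R vcnj2 v) * exp (herm lam (p - u) v)))"
  have mK: "S_kernel lam s \<phi> (rkernel lam u) p \<in> borel_measurable borel"
    using borel_measurable_integrable[OF int] by simp
  have eq: "S_kernel lam s \<phi> (rkernel lam u) p (u + v) = exp (herm lam p u) * cnj (g v * wlam lam v)" for v
  proof -
    have "S_kernel lam s \<phi> (rkernel lam u) p (u + v) = \<phi> (b - s *\<^sub>R vcnj2 v) *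
       (exp (herm lam (u + v) u) * exp (herm lam p (u + v)) * exp (- herm lam (u + v) (u + v)))"
      unfolding S_kernel_eq rkernel_def wlam_eq
      by (simp add: b_def vcnj2_add scaleR_add_right diff_diff_eq exp_of_real[symmetric] herm_diag_real)
    also have "exp (herm lam (u + v) u) * exp (herm lam p (u + v)) * exp (- herm lam (u + v) (u + v))
       = exp (herm lam p u) * (exp (herm lam (p - u) v) * exp (- herm lam v v))"
      unfolding exp_add[symmetric] by (simp add: herm_add_left herm_add_right herm_diff algebra_simps)
    also have "exp (- herm lam v v) = wlam lam v"
      by (simp add: wlam_eq exp_of_real[symmetric] herm_diag_real)
    finally show ?thesis by (simp add: g_def)
  qed
  have cont: "continuous_on UNIV g" unfolding g_def
    by (intro continuous_intros continuous_on_compose2[OF entire2_continuous_on[OF ent, of UNIV]]) auto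
  have hol: "(\<lambda>\<zeta>. g (cscale2 \<zeta> v)) holomorphic_on UNIV" for v
  proof -
    \<comment> \<open>The unconjugated function in the variable \<open>cnj \<zeta>\<close>;
      conjugating both inside and outside preserves holomorphy.\<close>
    define h where "h = (\<lambda>\<xi>. \<phi> (b + cscale2 \<xi> (- s *\<^sub>R vcnj2 v)) * exp (\<xi> * herm lam (p - u) v))"
    have "h holomorphic_on UNIV"
      unfolding h_def by (intro holomorphic_intros entire2_holomorphic_line[OF ent])
    then have "h holomorphic_on cnj ` UNIV" by (rule holomorphic_on_subset) simp
    then have "cnj \<circ> h \<circ> cnj holomorphic_on UNIV" by (rule holomorphic_on_compose_cnj_cnj) auto
    also have "cnj \<circ> h \<circ> cnj = (\<lambda>\<zeta>. g (cscale2 \<zeta> v))"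
      by (simp add: fun_eq_iff h_def g_def vcnj2_cscale2 cscale2_scaleR cscale2_minus_right herm_cscale_right)
    finally show ?thesis .
  qed
  have "integrable lborel (\<lambda>v. exp (herm lam p u) * cnj (g v * wlam lam v))"
    using integrable_lborel_translate[OF mK, of u] int by (simp add: eq)
  from integrable_mult_right[OF this, of "exp (- herm lam p u)"]
  have "integrable lborel (\<lambda>v. cnj (g v * wlam lam v))"
    by (simp only: mult.assoc[symmetric] mult_exp_exp) simp
  then have intg: "integrable lborel (\<lambda>v. g v * wlam lam v)" by (simp only: complex_integrable_cnj)
  have "S_op lam s \<phi> (rkernel lam u) p = (\<integral>v. exp (herm lam p u) * cnj (g v * wlam lam v) \<partial>lborel)"
    unfolding S_op_def using integral_lborel_translate[OF mK, of u] by (simp add: eq)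
  also have "\<dots> = exp (herm lam p u) * cnj (\<integral>v. g v * wlam lam v \<partial>lborel)"
    by (simp only: integral_mult_right_zero Bochner_Integration.integral_cnj)
  also have "(\<integral>v. g v * wlam lam v \<partial>lborel) = g 0 * of_real (\<integral>v. wlam lam (v :: 'n cvec2) \<partial>lborel)"
    by (rule integral_rotation_mean_value)
      (use cont hol continuous_on_wlam wlam_rotate intg in auto)
  finally show ?thesis by (simp add: g_def b_def vcnj2_0)
qed

text \<open>The image of \<open>rkernel lam u\<close> is evaluated at \<open>p\<close> and estimated
  by \<open>fock_evaluation_bound\<close> and the operator bound. Dividing by |exp H(p,u)|^2 turns
  exp (H(p,p) + H(u,u)) into exp H(p-u,p-u); a square root gives the claim.\<close>

lemma bounded_symbol_bound:
  fixes \<phi> :: "'n::finite cvec2 \<Rightarrow> complex"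
  assumes lam: "lam \<noteq> 0" and ent: "entire2 \<phi>"
    and bd: "bounded_on_fock lam (S_op lam s \<phi>) (S_kernel lam s \<phi>)"
  shows "\<exists>C. \<forall>p u. cmod (\<phi> (p - s *\<^sub>R vcnj2 u)) \<le> C * exp (Re (herm lam (p - u) (p - u)) / 2)"
proof -
  define I where "I = (\<integral>v. wlam lam (v :: 'n cvec2) \<partial>lborel)"
  have I: "I > 0" unfolding I_def by (rule integral_wlam_pos[OF lam])
  obtain C where C: "\<And>F. F \<in> fock lam \<Longrightarrow> (\<forall>p. integrable lborel (S_kernel lam s \<phi> F p)) \<and> S_op lam s \<phi> F \<in> fock lam
     \<and> fock_norm lam (S_op lam s \<phi> F) \<le> C * fock_norm lam F"
    using bd unfolding bounded_on_fock_def by blast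
  \<comment> \<open>The absolute value is taken because boundedness leaves the sign of
    \<open>C\<close> open; the divisor \<open>I\<close> is the factor produced by
    \<open>S_op_rkernel\<close>.\<close>
  have "cmod (\<phi> (p - s *\<^sub>R vcnj2 u)) \<le> \<bar>C\<bar> / I * exp (Re (herm lam (p - u) (p - u)) / 2)" for p u
  proof -
    let ?K = "rkernel lam u" and ?T = "S_op lam s \<phi> (rkernel lam u)" and ?b = "p - s *\<^sub>R vcnj2 u"
    let ?X = "\<integral>q. (cmod (?T q))\<^sup>2 * wlam lam q \<partial>lborel"
    note CK = C[OF rkernel_fock(1)[OF lam, of u]]
    have "sqrt ?X \<le> C * sqrt (exp (Re (herm lam u u)) * I)"
      using CK unfolding fock_norm_def rkernel_fock(2)[OF lam] I_def by simp
    moreover have "?X \<ge> 0" by (intro Bochner_Integration.integral_nonneg) (simp add: wlam_eq)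
    ultimately have "(sqrt ?X)\<^sup>2 \<le> (C * sqrt (exp (Re (herm lam u u)) * I))\<^sup>2"
      by (intro power_mono) auto
    then have X: "?X \<le> C\<^sup>2 * (exp (Re (herm lam u u)) * I)"
      using \<open>?X \<ge> 0\<close> I by (simp add: power_mult_distrib)
    have "(cmod (?T p))\<^sup>2 * I \<le> exp (Re (herm lam p p)) * ?X"
      unfolding I_def using CK by (intro fock_evaluation_bound) auto
    also have "\<dots> \<le> exp (Re (herm lam p p)) * (C\<^sup>2 * (exp (Re (herm lam u u)) * I))"
      using X by (intro mult_left_mono) auto
    finally have "(cmod (?T p))\<^sup>2 \<le> exp (Re (herm lam p p)) * (C\<^sup>2 * exp (Re (herm lam u u)))"
      using I by (simp add: mult.assoc[symmetric])
    moreover have "(cmod (?T p))\<^sup>2 = exp (2 * Re (herm lam p u)) * (cmod (\<phi> ?b))\<^sup>2 * I\<^sup>2"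
      using S_op_rkernel[OF ent, of lam s u p] CK
      by (simp add: norm_mult power_mult_distrib exp_double I_def)
    ultimately have "exp (2 * Re (herm lam p u)) * ((cmod (\<phi> ?b))\<^sup>2 * I\<^sup>2) \<le>
        exp (2 * Re (herm lam p u)) * (C\<^sup>2 * exp (Re (herm lam (p - u) (p - u))))"
      by (simp add: Re_herm_diff exp_add exp_diff mult_ac)
    then have "(cmod (\<phi> ?b) * I)\<^sup>2 \<le> (\<bar>C\<bar> * exp (Re (herm lam (p - u) (p - u)) / 2))\<^sup>2"
      by (simp add: power_mult_distrib exp_double[symmetric])
    then have "cmod (\<phi> ?b) * I \<le> \<bar>C\<bar> * exp (Re (herm lam (p - u) (p - u)) / 2)"
      by (rule power2_le_imp_le) simp
    then show ?thesis using I by (simp add: field_simps)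
  qed
  then show ?thesis by blast
qed

section \<open>Constancy of the symbol when both operators are bounded\<close>

theorem theorem1p3:
  fixes lam :: real and \<phi> :: "('n::finite) cvec2 \<Rightarrow> complex"
  assumes "lam \<noteq> 0"
    and "\<phi> \<in> fock lam"
    and "\<not> (\<exists>c. \<forall>p. \<phi> p = c)"
  shows "\<not> bounded_on_fock lam (S_op lam 1 \<phi>) (S_kernel lam 1 \<phi>)
       \<or> \<not> bounded_on_fock lam (S_op lam (-1) \<phi>) (S_kernel lam (-1) \<phi>)"
proof (rule ccontr)
  assume "\<not> ?thesis"
  then have b1: "bounded_on_fock lam (S_op lam 1 \<phi>) (S_kernel lam 1 \<phi>)"
    and b2: "bounded_on_fock lam (S_op lam (-1) \<phi>) (S_kernel lam (-1) \<phi>)" by auto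
  have ent: "entire2 \<phi>" using assms(2) by (simp add: fock_def)
  obtain C1 where C1: "\<And>p u. cmod (\<phi> (p - 1 *\<^sub>R vcnj2 u)) \<le> C1 * exp (Re (herm lam (p - u) (p - u)) / 2)"
    using bounded_symbol_bound[OF assms(1) ent b1] by blast
  obtain C2 where C2: "\<And>p u. cmod (\<phi> (p - (- 1) *\<^sub>R vcnj2 u)) \<le> C2 * exp (Re (herm lam (p - u) (p - u)) / 2)"
    using bounded_symbol_bound[OF assms(1) ent b2] by blast
  have real: "\<phi> x = \<phi> 0" if x: "vcnj2 x = x" for x
  proof -
    define k where "k = Re (herm lam x x) / 2"
    have "0 \<le> (lam * coth lam - \<bar>lam\<bar>) / 2 * (norm x)\<^sup>2" using mult_coth_gt_abs[OF assms(1)] by simp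
    then have k: "k \<ge> 0" using Re_herm_ge[of lam x] unfolding k_def by linarith
    have scaled: "Re (herm lam (cscale2 c x) (cscale2 c x)) / 2 = k * (cmod c)\<^sup>2" for c
    proof -
      have "herm lam (cscale2 c x) (cscale2 c x) = of_real ((cmod c)\<^sup>2) * herm lam x x"
        unfolding herm_cscale_left herm_cscale_right complex_norm_square by (simp only: mult_ac)
      then show ?thesis by (simp only: Re_complex_of_real k_def times_complex.sel Im_complex_of_real) simp
    qed
    have diff: "cscale2 a x - cscale2 b x = cscale2 (a - b) x" for a b
      using cscale2_add[of "a - b" b x] by simp
    \<comment> \<open>The parameters 1 and 0 are compared on the complex line through 0 and
      \<open>x\<close>; the summand 0 matches the shape of
      \<open>entire2_holomorphic_line\<close>.\<close>
    have "\<phi> (0 + cscale2 1 x) = \<phi> (0 + cscale2 0 x)"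
    proof (rule entire_gaussian_min_bound_constant[OF entire2_holomorphic_line[OF ent] k, where C = "max C1 C2"])
      fix z
      \<comment> \<open>p and u are chosen so that the symbol is evaluated at z x while p - u is the real
        (for sign 1) or the imaginary (for sign -1) part of z x.\<close>
      let ?p = "cscale2 (Re z + \<i> * Im z / 2) x" and ?u = "cscale2 (\<i> * Im z / 2) x"
      have "?p - 1 *\<^sub>R vcnj2 ?u = cscale2 z x" "?p - ?u = cscale2 (Re z) x"
        unfolding vcnj2_cscale2 x diff scaleR_one
        by (rule arg_cong[of _ _ "\<lambda>c. cscale2 c x"], simp add: complex_eq_iff)+
      then have r: "cmod (\<phi> (cscale2 z x)) \<le> C1 * exp (k * (Re z)\<^sup>2)"
        using C1[of ?p ?u] scaled[of "Re z"] by (simp only:) simp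
      let ?p = "cscale2 (Re z / 2 + \<i> * Im z) x" and ?u = "cscale2 (Re z / 2) x"
      have "?p - (- 1) *\<^sub>R vcnj2 ?u = cscale2 z x" "?p - ?u = cscale2 (\<i> * Im z) x"
        unfolding vcnj2_cscale2 x diff scaleR_minus_left scaleR_one minus_minus diff_minus_eq_add cscale2_add[symmetric]
        by (rule arg_cong[of _ _ "\<lambda>c. cscale2 c x"], simp add: complex_eq_iff)+
      then have i: "cmod (\<phi> (cscale2 z x)) \<le> C2 * exp (k * (Im z)\<^sup>2)"
        using C2[of ?p ?u] scaled[of "\<i> * Im z"] by (simp only:) (simp add: norm_mult)
      have "C1 * exp t \<le> max C1 C2 * exp t" "C2 * exp t \<le> max C1 C2 * exp t" for t
        by (auto intro!: mult_right_mono)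
      then show "cmod (\<phi> (0 + cscale2 z x)) \<le> max C1 C2 * exp (k * min ((Re z)\<^sup>2) ((Im z)\<^sup>2))"
        using r i by (smt (verit) add_0 min_def)
    qed
    then show ?thesis by (simp add: cscale2_1 cscale2_0)
  qed
  have "\<phi> v = \<phi> 0" for v
  proof -
    \<comment> \<open>Coordinatewise real and imaginary parts of \<open>v\<close>.\<close>
    define x where "x = (1/2) *\<^sub>R (v + vcnj2 v)"
    define y where "y = cscale2 (- \<i> / 2) (v - vcnj2 v)"
    have xr: "vcnj2 x = x" and yr: "vcnj2 y = y" and v: "x + cscale2 \<i> y = v"
      by (simp_all add: x_def y_def vcnj2_def vcnj_def cscale2_def prod_eq_iff vec_eq_iff complex_eq_iff)
    have "\<phi> (x + cscale2 \<i> y) - \<phi> 0 = 0"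
    \<comment> \<open>For real \<open>\<zeta>\<close> the point is a real vector, where
      \<open>\<phi>\<close> equals \<open>\<phi> 0\<close>. The reals accumulate at 0, so the
      equality extends to \<open>\<zeta>\<close> = i, where the point is \<open>v\<close>.\<close>
    proof (rule analytic_continuation[of "\<lambda>\<zeta>. \<phi> (x + cscale2 \<zeta> y) - \<phi> 0" UNIV \<real> 0])
      show "(\<lambda>\<zeta>. \<phi> (x + cscale2 \<zeta> y) - \<phi> 0) holomorphic_on UNIV"
        by (intro holomorphic_intros entire2_holomorphic_line[OF ent])
      show "(0::complex) islimpt \<real>"
      proof (clarsimp simp: islimpt_approachable)
        fix e :: real assume "e > 0"
        then show "\<exists>x'\<in>\<real>. x' \<noteq> (0::complex) \<and> cmod x' < e"
          by (intro bexI[of _ "of_real (e / 2)"]) auto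
      qed
      fix \<zeta> :: complex assume "\<zeta> \<in> \<real>"
      then have "vcnj2 (x + cscale2 \<zeta> y) = x + cscale2 \<zeta> y"
        by (simp add: vcnj2_add vcnj2_cscale2 xr yr Reals_cnj_iff)
      then show "\<phi> (x + cscale2 \<zeta> y) - \<phi> 0 = 0" using real by simp
    qed auto
    then show ?thesis by (simp add: v)
  qed
  then show False using assms(3) by blast
qed

end
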